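(* For every integer $n\ge 1$, the square grid graph $G_n$ is similar to the disjoint union of two copies of the quartered Aztec diamond $QAD_{n-1}$ with $P_n^{(2)}$: $$G_n\sim QAD_{n-1}\ \dot{\cup}\ QAD_{n-1}\ \dot{\cup}\ P_n^{(2)}.$$
   Context: The adjacency matrix of a weighted graph has rows and columns indexed by the vertices, its $(u,v)$-entry being the weight of the edge between $u$ and $v$ if there is one, and $0$ otherwise; unweighted graphs are regarded as weighted graphs with all weights equal to $1$. Two graphs $G_1,G_2$ are called similar, written $G_1\sim G_2$, if their adjacency matrices are similar matrices. $\dot\cup$ denotes disjoint union. $G_n$ is the $n\times n$ grid graph (the subgraph of $\mathbb{Z}^2$ with nearest-neighbor edges induced by $\{1,\dots,n\}^2$). The Aztec diamond $AD_n$ is the subgraph of the grid $(\mathbb{Z}+1/2)^2$ (nearest-neighbor edges) induced by the vertices $(x,y)$ with $|x|+|y|\le n$. The quartered Aztec diamond $QAD_n$ is the subgraph of $AD_n$ induced by the vertices in its southeastern quarter ($x>0$, $y<0$); equivalently, up to isomorphism, it is the subgraph of $\mathbb{Z}^2$ induced by the points $(i,j)$ with $i,j\ge1$, $i+j\le n+1$ ($QAD_0$ is the empty graph). $P_n^{(2)}$ is the path on $n$ vertices with all edge weights equal to $2$. *)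

theory Defs
  imports Complex_Main "Jordan_Normal_Form.Matrix"
begin

text \<open>
  A weighted graph has edges that are two-element sets of vertices; only the values of
  \<open>weight\<close> on \<open>edges\<close> are meaningful. The vertex set may be infinite (as for the
  square lattice); \<open>simple_wgraph\<close> states that the edges are indeed pairs of
  distinct vertices.
\<close>

record 'a wgraph =
  verts :: "'a set"
  edges :: "'a set set"
  weight :: "'a set \<Rightarrow> real"

definition simple_wgraph :: "'a wgraph \<Rightarrow> bool" where
  "simple_wgraph G \<longleftrightarrow> (\<forall>e \<in> edges G. \<exists>u \<in> verts G. \<exists>v \<in> verts G. u \<noteq> v \<and> e = {u, v})"

definition adj_entry :: "'a wgraph \<Rightarrow> 'a \<Rightarrow> 'a \<Rightarrow> real" where
  "adj_entry G u v = (if {u, v} \<in> edges G then weight G {u, v} else 0)"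

text \<open>
  Library matrices are indexed by initial segments of the naturals, so an adjacency matrix
  refers to an enumeration of the vertices.
\<close>

definition adj_mat :: "'a wgraph \<Rightarrow> 'a list \<Rightarrow> real mat" where
  "adj_mat G vs = mat (length vs) (length vs) (\<lambda>(i, j). adj_entry G (vs ! i) (vs ! j))"

definition vertex_enum :: "'a wgraph \<Rightarrow> 'a list \<Rightarrow> bool" where
  "vertex_enum G vs \<longleftrightarrow> distinct vs \<and> set vs = verts G"

text \<open>
  Different enumerations give permutation-similar matrices. Similarity is required for all of
  them; this is not vacuous, since finite vertex sets have enumerations.
\<close>

definition similar_graphs :: "'a wgraph \<Rightarrow> 'b wgraph \<Rightarrow> bool" (infix \<open>\<sim>\<^sub>G\<close> 50) where
  "G \<sim>\<^sub>G H \<longleftrightarrow> finite (verts G) \<and> finite (verts H) \<and>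
     (\<forall>us vs. vertex_enum G us \<longrightarrow> vertex_enum H vs \<longrightarrow> similar_mat (adj_mat G us) (adj_mat H vs))"

definition induced_subgraph :: "'a wgraph \<Rightarrow> 'a set \<Rightarrow> 'a wgraph" where
  "induced_subgraph G S =
     \<lparr>verts = verts G \<inter> S, edges = {e \<in> edges G. e \<subseteq> S}, weight = weight G\<rparr>"

definition disjoint_union :: "'a wgraph \<Rightarrow> 'b wgraph \<Rightarrow> ('a + 'b) wgraph" (infixr \<open>\<union>\<^sub>G\<close> 65) where
  "G \<union>\<^sub>G H =
     \<lparr>verts = Inl ` verts G \<union> Inr ` verts H,
      edges = image Inl ` edges G \<union> image Inr ` edges H,
      weight = (\<lambda>e. if e \<subseteq> range Inl then weight G (Inl -` e) else weight H (Inr -` e))\<rparr>"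

definition nearest_neighbor_graph :: "('a::linordered_idom \<times> 'a) set \<Rightarrow> ('a \<times> 'a) wgraph" where
  "nearest_neighbor_graph S =
     \<lparr>verts = S,
      edges = {{p, q} | p q. p \<in> S \<and> q \<in> S \<and> \<bar>fst p - fst q\<bar> + \<bar>snd p - snd q\<bar> = 1},
      weight = (\<lambda>_. 1)\<rparr>"

definition int_lattice :: "(int \<times> int) wgraph" where
  "int_lattice = nearest_neighbor_graph UNIV"

definition half_int_lattice :: "(real \<times> real) wgraph" where
  "half_int_lattice = nearest_neighbor_graph {(x, y). x - 1/2 \<in> \<int> \<and> y - 1/2 \<in> \<int>}"

definition grid_graph :: "nat \<Rightarrow> (int \<times> int) wgraph" where
  "grid_graph n = induced_subgraph int_lattice ({1..int n} \<times> {1..int n})"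

definition aztec_diamond :: "nat \<Rightarrow> (real \<times> real) wgraph" where
  "aztec_diamond n = induced_subgraph half_int_lattice {(x, y). \<bar>x\<bar> + \<bar>y\<bar> \<le> real n}"

definition quartered_aztec_diamond :: "nat \<Rightarrow> (real \<times> real) wgraph" where
  "quartered_aztec_diamond n = induced_subgraph (aztec_diamond n) {(x, y). x > 0 \<and> y < 0}"

definition weighted_path :: "real \<Rightarrow> nat \<Rightarrow> nat wgraph" where
  "weighted_path c n = \<lparr>verts = {1..n}, edges = {{i, Suc i} | i. 1 \<le> i \<and> i < n}, weight = (\<lambda>_. c)\<rparr>"


lemma simple_nearest_neighbor_graph: "simple_wgraph (nearest_neighbor_graph S)"
  unfolding simple_wgraph_def
proof
  fix e assume "e \<in> edges (nearest_neighbor_graph S)"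
  then obtain p q where e: "e = {p, q}" "p \<in> S" "q \<in> S"
    and d: "\<bar>fst p - fst q\<bar> + \<bar>snd p - snd q\<bar> = 1"
    unfolding nearest_neighbor_graph_def wgraph.simps mem_Collect_eq by blast
  have "p \<noteq> q"
  proof
    assume "p = q"
    with d show False by simp
  qed
  moreover have "verts (nearest_neighbor_graph S) = S"
    by (simp only: nearest_neighbor_graph_def wgraph.simps)
  ultimately show "\<exists>u \<in> verts (nearest_neighbor_graph S). \<exists>v \<in> verts (nearest_neighbor_graph S).
      u \<noteq> v \<and> e = {u, v}"
    using e by blast
qed

lemma simple_induced_subgraph:
  assumes "simple_wgraph G"
  shows "simple_wgraph (induced_subgraph G S)"
  unfolding simple_wgraph_def
proof
  fix e assume "e \<in> edges (induced_subgraph G S)"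
  then have e: "e \<in> edges G" "e \<subseteq> S" by (simp_all add: induced_subgraph_def)
  then obtain u v where uv: "u \<in> verts G" "v \<in> verts G" "u \<noteq> v" "e = {u, v}"
    using assms unfolding simple_wgraph_def by blast
  have "verts (induced_subgraph G S) = verts G \<inter> S" by (simp add: induced_subgraph_def)
  with e(2) uv show "\<exists>u \<in> verts (induced_subgraph G S). \<exists>v \<in> verts (induced_subgraph G S).
      u \<noteq> v \<and> e = {u, v}"
    by blast
qed

lemma simple_weighted_path: "simple_wgraph (weighted_path c n)"
  unfolding simple_wgraph_def
proof
  fix e assume "e \<in> edges (weighted_path c n)"
  then obtain i where "1 \<le> i" "i < n" "e = {i, Suc i}"
    unfolding weighted_path_def wgraph.simps mem_Collect_eq by blast
  then show "\<exists>u \<in> verts (weighted_path c n). \<exists>v \<in> verts (weighted_path c n). u \<noteq> v \<and> e = {u, v}"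
    by (intro bexI[of _ i] bexI[of _ "Suc i"]) (simp_all add: weighted_path_def)
qed

lemma simple_disjoint_union:
  assumes "simple_wgraph G" "simple_wgraph H"
  shows "simple_wgraph (G \<union>\<^sub>G H)"
proof -
  have "\<exists>u \<in> verts (G \<union>\<^sub>G H). \<exists>v \<in> verts (G \<union>\<^sub>G H). u \<noteq> v \<and> e = {u, v}"
    if e: "e \<in> edges (G \<union>\<^sub>G H)" for e
  proof -
    consider e' where "e' \<in> edges G" "e = Inl ` e'" | e' where "e' \<in> edges H" "e = Inr ` e'"
      using e by (auto simp: disjoint_union_def)
    then show ?thesis
    proof cases
      case 1
      then obtain u v where "u \<in> verts G" "v \<in> verts G" "u \<noteq> v" "e' = {u, v}"
        using assms(1) unfolding simple_wgraph_def by blast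
      with 1 show ?thesis
        by (intro bexI[of _ "Inl u"] bexI[of _ "Inl v"]) (auto simp: disjoint_union_def)
    next
      case 2
      then obtain u v where "u \<in> verts H" "v \<in> verts H" "u \<noteq> v" "e' = {u, v}"
        using assms(2) unfolding simple_wgraph_def by blast
      with 2 show ?thesis
        by (intro bexI[of _ "Inr u"] bexI[of _ "Inr v"]) (auto simp: disjoint_union_def)
    qed
  qed
  then show ?thesis unfolding simple_wgraph_def by blast
qed

lemma adj_entry_disjoint_union:
  "adj_entry (G \<union>\<^sub>G H) (Inl u) (Inl u') = adj_entry G u u'"
  "adj_entry (G \<union>\<^sub>G H) (Inr v) (Inr v') = adj_entry H v v'"
  "adj_entry (G \<union>\<^sub>G H) (Inl u) (Inr v) = 0"
  "adj_entry (G \<union>\<^sub>G H) (Inr v) (Inl u) = 0"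
proof -
  have [simp]: "{Inl a, Inl b} = Inl ` e \<longleftrightarrow> e = {a, b}" for a b :: 'a and e
    using inj_image_eq_iff[OF inj_Inl, of "{a, b}" e] by auto
  have [simp]: "{Inr a, Inr b} = Inr ` e \<longleftrightarrow> e = {a, b}" for a b :: 'b and e
    using inj_image_eq_iff[OF inj_Inr, of "{a, b}" e] by auto
  have [simp]: "Inl -` {Inl a, Inl b} = {a, b}" for a b :: 'a by auto
  have [simp]: "Inr -` {Inr a, Inr b} = {a, b}" for a b :: 'b by auto
  show "adj_entry (G \<union>\<^sub>G H) (Inl u) (Inl u') = adj_entry G u u'"
       "adj_entry (G \<union>\<^sub>G H) (Inr v) (Inr v') = adj_entry H v v'"
       "adj_entry (G \<union>\<^sub>G H) (Inl u) (Inr v) = 0"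
       "adj_entry (G \<union>\<^sub>G H) (Inr v) (Inl u) = 0"
    by (auto simp: adj_entry_def disjoint_union_def image_iff)
qed

lemma verts_quartered_aztec_diamond:
  "verts (quartered_aztec_diamond n) =
     (\<lambda>(i, j). (real i - 1/2, 1/2 - real j)) ` {(i, j). 1 \<le> i \<and> 1 \<le> j \<and> i + j \<le> n + 1}"
  (is "?L = ?R")
proof
  show "?R \<subseteq> ?L"
  proof
    fix p assume "p \<in> ?R"
    then obtain i j where p: "p = (real i - 1/2, 1/2 - real j)"
      and ij: "1 \<le> i" "1 \<le> j" "i + j \<le> n + 1" by auto
    have a: "1 \<le> real i" "1 \<le> real j" using ij by auto
    have b: "real i + real j \<le> real n + 1" using ij(3) by linarith
    have "(real i - 1/2) - 1/2 = of_int (int i - 1)" "(1/2 - real j) - 1/2 = of_int (- int j)" by auto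
    then have "(real i - 1/2) - 1/2 \<in> \<int>" "(1/2 - real j) - 1/2 \<in> \<int>" by (metis Ints_of_int)+
    with a b show "p \<in> ?L"
      by (auto simp: p quartered_aztec_diamond_def aztec_diamond_def half_int_lattice_def
          nearest_neighbor_graph_def induced_subgraph_def)
  qed
  show "?L \<subseteq> ?R"
  proof
    fix p assume "p \<in> ?L"
    then obtain x y where p: "p = (x, y)" and xy: "x - 1/2 \<in> \<int>" "y - 1/2 \<in> \<int>"
      "\<bar>x\<bar> + \<bar>y\<bar> \<le> real n" "x > 0" "y < 0"
      by (auto simp: quartered_aztec_diamond_def aztec_diamond_def half_int_lattice_def
          nearest_neighbor_graph_def induced_subgraph_def)
    obtain a b :: int where ab: "x - 1/2 = of_int a" "y - 1/2 = of_int b"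
      using xy(1,2) by (auto elim!: Ints_cases)
    have "of_int a > (-1 :: real)" "of_int b < (0 :: real)" using ab xy by linarith+
    then have ab0: "a \<ge> 0" "b < 0" by linarith+
    have "real_of_int (a - b) \<le> real n" using ab xy by auto
    then have "a - b \<le> int n" by linarith
    with ab ab0 show "p \<in> ?R"
      by (intro image_eqI[of _ _ "(nat (a + 1), nat (- b))"]) (auto simp: p)
  qed
qed

lemma finite_verts_quartered_aztec_diamond: "finite (verts (quartered_aztec_diamond n))"
  unfolding verts_quartered_aztec_diamond
  by (intro finite_imageI, rule finite_subset[of _ "{..n + 1} \<times> {..n + 1}"]) auto

end

theory Submission
  imports Defs "Jordan_Normal_Form.Determinant"
begin

text \<open>
  Identify functions on the grid with \<open>n \<times> n\<close> matrices \<open>X\<close>, and let \<open>S\<close> be the adjacency matrix of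
  the path. The grid adjacency operator is the anticommutator \<open>D X = S X + X S\<close>; it commutes with
  the commutator \<open>M X = S X - X S\<close> and with transposition. On antisymmetric matrices, which are
  determined by their entries above the diagonal, \<open>D\<close> is the adjacency operator of the quartered
  Aztec diamond. On the kernel of \<open>M\<close>, which consists of the polynomials in \<open>S\<close>, \<open>D\<close> is
  multiplication by \<open>2 S\<close>; in the basis \<open>U\<^sub>k\<^sub>-\<^sub>1(S)\<close> of Chebyshev polynomials this is the adjacency
  operator of the path with weights 2. So
  \<open>(f\<^sub>1, f\<^sub>2, h) \<mapsto> f\<^sub>1 + M f\<^sub>2 + (\<Sum>k. h\<^sub>k U\<^sub>k\<^sub>-\<^sub>1(S))\<close>, with \<open>f\<^sub>1, f\<^sub>2\<close> antisymmetric, intertwines the two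
  adjacency operators. It is injective: \<open>M\<close> maps antisymmetric to symmetric matrices, it is
  self-adjoint, so its image is orthogonal to its kernel, and its kernel is symmetric. Both graphs
  have \<open>n\<^sup>2\<close> vertices.
\<close>

section \<open>The commutator and anticommutator with the path\<close>

text \<open>Summation by parts: the adjacency operator of the path is symmetric. The zero values at
  \<open>0\<close> and \<open>n + 1\<close> kill the boundary terms of the two shifts.\<close>

lemma sum_shift_adjoint:
  fixes a b :: "int \<Rightarrow> real"
  assumes "a 0 = 0" "a (n + 1) = 0" "b 0 = 0" "b (n + 1) = 0"
  shows "(\<Sum>i\<in>{1..n}. (a (i - 1) + a (i + 1)) * b i) = (\<Sum>i\<in>{1..n}. a i * (b (i - 1) + b (i + 1)))"
proof -
  have shift: "(\<Sum>i\<in>{1..n}. c (i + 1) * d i) = (\<Sum>i\<in>{1..n}. c i * d (i - 1))"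
    if "c (n + 1) = 0" "d 0 = 0" for c d :: "int \<Rightarrow> real"
  proof -
    have "(\<Sum>i\<in>{1..n}. c (i + 1) * d i) = (\<Sum>i\<in>{2..n+1}. c i * d (i - 1))"
      by (rule sum.reindex_bij_witness[of _ "\<lambda>i. i - 1" "\<lambda>i. i + 1"]) auto
    also have "\<dots> = (\<Sum>i\<in>{1..n+1}. c i * d (i - 1))"
    proof (rule sum.mono_neutral_left)
      show "\<forall>i\<in>{1..n+1} - {2..n+1}. c i * d (i - 1) = 0"
      proof
        fix i assume "i \<in> {1..n+1} - {2..n+1}"
        then have "i = 1" by auto
        with that show "c i * d (i - 1) = 0" by simp
      qed
    qed auto
    also have "\<dots> = (\<Sum>i\<in>{1..n}. c i * d (i - 1))"
    proof (rule sum.mono_neutral_right)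
      show "\<forall>i\<in>{1..n+1} - {1..n}. c i * d (i - 1) = 0"
      proof
        fix i assume "i \<in> {1..n+1} - {1..n}"
        then have "i = n + 1" by auto
        with that show "c i * d (i - 1) = 0" by simp
      qed
    qed auto
    finally show ?thesis .
  qed
  show ?thesis
    using shift[of a b] shift[of b a] assms
    by (simp add: algebra_simps sum.distrib)
qed

text \<open>Matrices are functions on all pairs of integers, so a neighbour index \<open>0\<close>
  or \<open>n + 1\<close> is legal and contributes 0; no boundary cases arise.\<close>

definition supported :: "int \<Rightarrow> (int \<Rightarrow> int \<Rightarrow> real) \<Rightarrow> bool" where
  "supported n X \<longleftrightarrow> (\<forall>i j. i \<notin> {1..n} \<or> j \<notin> {1..n} \<longrightarrow> X i j = 0)"

text \<open>On supported \<open>X\<close> this is the product \<open>S X\<close>, and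
  \<open>col_op\<close> is \<open>X S\<close>. The cutoff keeps the result supported, so that the
  operators can be composed.\<close>

definition row_op :: "int \<Rightarrow> (int \<Rightarrow> int \<Rightarrow> real) \<Rightarrow> int \<Rightarrow> int \<Rightarrow> real" where
  "row_op n X i j = (if i \<in> {1..n} \<and> j \<in> {1..n} then X (i - 1) j + X (i + 1) j else 0)"

definition col_op :: "int \<Rightarrow> (int \<Rightarrow> int \<Rightarrow> real) \<Rightarrow> int \<Rightarrow> int \<Rightarrow> real" where
  "col_op n X i j = (if i \<in> {1..n} \<and> j \<in> {1..n} then X i (j - 1) + X i (j + 1) else 0)"

definition commutator :: "int \<Rightarrow> (int \<Rightarrow> int \<Rightarrow> real) \<Rightarrow> int \<Rightarrow> int \<Rightarrow> real" where
  "commutator n X i j = row_op n X i j - col_op n X i j"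

definition anticommutator :: "int \<Rightarrow> (int \<Rightarrow> int \<Rightarrow> real) \<Rightarrow> int \<Rightarrow> int \<Rightarrow> real" where
  "anticommutator n X i j = row_op n X i j + col_op n X i j"

lemma supported_ops:
  "supported n (row_op n X)" "supported n (col_op n X)"
  "supported n (commutator n X)" "supported n (anticommutator n X)"
  by (auto simp: supported_def row_op_def col_op_def commutator_def anticommutator_def)

text \<open>Associativity: \<open>S (X S) = (S X) S\<close>.\<close>

lemma row_col_op_commute:
  assumes "supported n X"
  shows "row_op n (col_op n X) i j = col_op n (row_op n X) i j"
proof (cases "i \<in> {1..n} \<and> j \<in> {1..n}")
  case True
  \<comment> \<open>No bound on \<open>a\<close> is needed: off the square both sides are 0, so the
    shifted indices \<open>i - 1\<close> and \<open>i + 1\<close> are covered.\<close>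
  have c: "col_op n X a j = X a (j - 1) + X a (j + 1)" for a
    using True assms by (auto simp: col_op_def supported_def)
  have r: "row_op n X i b = X (i - 1) b + X (i + 1) b" for b
    using True assms by (auto simp: row_op_def supported_def)
  show ?thesis
    using True by (simp add: row_op_def[of n "col_op n X"] col_op_def[of n "row_op n X"] c r)
qed (auto simp: row_op_def col_op_def)

text \<open>Both compositions equal \<open>S S X - X S S\<close>, because the mixed terms
  \<open>S X S\<close> cancel.\<close>

lemma anticommutator_commutator:
  assumes "supported n X"
  shows "anticommutator n (commutator n X) i j = commutator n (anticommutator n X) i j"
proof -
  have "anticommutator n (commutator n X) i j =
      row_op n (row_op n X) i j - row_op n (col_op n X) i j
      + col_op n (row_op n X) i j - col_op n (col_op n X) i j"
    by (simp add: anticommutator_def commutator_def row_op_def[of n "commutator n X"]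
        row_op_def[of n "row_op n X"] row_op_def[of n "col_op n X"] col_op_def[of n "commutator n X"]
        col_op_def[of n "row_op n X"] col_op_def[of n "col_op n X"])
  moreover have "commutator n (anticommutator n X) i j =
      row_op n (row_op n X) i j + row_op n (col_op n X) i j
      - col_op n (row_op n X) i j - col_op n (col_op n X) i j"
    by (simp add: anticommutator_def commutator_def row_op_def[of n "anticommutator n X"]
        row_op_def[of n "row_op n X"] row_op_def[of n "col_op n X"] col_op_def[of n "anticommutator n X"]
        col_op_def[of n "row_op n X"] col_op_def[of n "col_op n X"])
  ultimately show ?thesis
    using row_col_op_commute[OF assms] by simp
qed

lemma commutator_add:
  "commutator n (\<lambda>i j. X i j + Y i j) i j = commutator n X i j + commutator n Y i j"
  by (simp add: commutator_def row_op_def col_op_def)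

lemma commutator_scale:
  "commutator n (\<lambda>i j. c * X i j) i j = c * commutator n X i j"
  by (simp add: commutator_def row_op_def col_op_def algebra_simps)

lemma anticommutator_add:
  "anticommutator n (\<lambda>i j. X i j + Y i j) i j = anticommutator n X i j + anticommutator n Y i j"
  by (simp add: anticommutator_def row_op_def col_op_def)

lemma commutator_transpose_antisym:
  assumes "\<And>i j. X j i = - X i j"
  shows "commutator n X j i = commutator n X i j"
  using assms[of "i - 1"] assms[of "i + 1"] assms[of _ "j - 1"] assms[of _ "j + 1"]
  by (simp add: commutator_def row_op_def col_op_def)

text \<open>Self-adjointness for the entrywise inner product: summation by parts along each column
  for \<open>row_op\<close>, along each row for \<open>col_op\<close>.\<close>

lemma commutator_adjoint:
  assumes X: "supported n X" and Y: "supported n Y"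
  shows "(\<Sum>i\<in>{1..n}. \<Sum>j\<in>{1..n}. commutator n X i j * Y i j) =
    (\<Sum>i\<in>{1..n}. \<Sum>j\<in>{1..n}. X i j * commutator n Y i j)"
proof -
  have 0: "X 0 j = 0" "X (n + 1) j = 0" "X i 0 = 0" "X i (n + 1) = 0"
      "Y 0 j = 0" "Y (n + 1) j = 0" "Y i 0 = 0" "Y i (n + 1) = 0" for i j
    using X Y by (auto simp: supported_def)
  have row: "(\<Sum>i\<in>{1..n}. \<Sum>j\<in>{1..n}. row_op n X i j * Y i j) =
    (\<Sum>i\<in>{1..n}. \<Sum>j\<in>{1..n}. X i j * row_op n Y i j)"
  proof (subst (1 2) sum.swap, rule sum.cong[OF refl])
    fix j assume "j \<in> {1..n}"
    then show "(\<Sum>i\<in>{1..n}. row_op n X i j * Y i j) = (\<Sum>i\<in>{1..n}. X i j * row_op n Y i j)"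
      using sum_shift_adjoint[of "\<lambda>i. X i j" n "\<lambda>i. Y i j"]
      by (simp add: row_op_def 0)
  qed
  have col: "(\<Sum>i\<in>{1..n}. \<Sum>j\<in>{1..n}. col_op n X i j * Y i j) =
    (\<Sum>i\<in>{1..n}. \<Sum>j\<in>{1..n}. X i j * col_op n Y i j)"
  proof (rule sum.cong[OF refl])
    fix i assume "i \<in> {1..n}"
    then show "(\<Sum>j\<in>{1..n}. col_op n X i j * Y i j) = (\<Sum>j\<in>{1..n}. X i j * col_op n Y i j)"
      using sum_shift_adjoint[of "X i" n "Y i"]
      by (simp add: col_op_def 0)
  qed
  show ?thesis
    using row col by (simp add: commutator_def left_diff_distrib right_diff_distrib sum_subtractf)
qed

section \<open>Matrices commuting with the path\<close>

text \<open>
  \<open>fusion n i j k\<close> is the \<open>(i, j)\<close> entry of \<open>U\<^sub>k\<^sub>-\<^sub>1(S)\<close>, in closed form.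
\<close>

definition fusion :: "int \<Rightarrow> int \<Rightarrow> int \<Rightarrow> int \<Rightarrow> real" where
  "fusion n i j k =
    (if odd (i + j + k) \<and> i < j + k \<and> j < i + k \<and> k < i + j \<and> i + j + k < 2 * n + 2 then 1 else 0)"

lemma fusion_commute: "fusion n j i k = fusion n i j k"
  by (auto simp: fusion_def algebra_simps)

lemma fusion_eq_0: "i \<notin> {1..n} \<or> j \<notin> {1..n} \<or> k \<notin> {1..n} \<Longrightarrow> fusion n i j k = 0"
  by (auto simp: fusion_def)

text \<open>The first column of the k-th basis matrix is the k-th unit vector, so a combination of
  these matrices shows its coefficients in its first column.\<close>

lemma fusion_1:
  assumes "i \<in> {1..n}"
  shows "fusion n i 1 k = (if k = i then 1 else 0)"
  using assms by (auto simp: fusion_def)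

text \<open>The Chebyshev recurrence: multiplying the k-th basis matrix by \<open>S\<close> gives
  the sum of its two neighbours in the basis.\<close>

lemma fusion_recurrence:
  assumes "i \<in> {1..n}" "j \<in> {1..n}" "k \<in> {1..n}"
  shows "fusion n (i - 1) j k + fusion n (i + 1) j k = fusion n i j (k - 1) + fusion n i j (k + 1)"
proof (cases "even (i + j + k)")
  case True
  then obtain m where m: "i + j + k = 2 * m" by blast
  \<comment> \<open>Eliminating \<open>k\<close> removes the parity condition and leaves linear
    inequalities. If \<open>i + j + k\<close> is odd, all four terms vanish by parity.\<close>
  have k: "k = 2 * m - i - j" using m by simp
  show ?thesis using assms unfolding k fusion_def by (auto; presburger)
qed (auto simp: fusion_def)

definition fusion_comb :: "int \<Rightarrow> (int \<Rightarrow> real) \<Rightarrow> int \<Rightarrow> int \<Rightarrow> real" where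
  "fusion_comb n h i j = (\<Sum>k\<in>{1..n}. h k * fusion n i j k)"

lemma fusion_comb_add:
  "fusion_comb n (\<lambda>k. g k + h k) i j = fusion_comb n g i j + fusion_comb n h i j"
  by (simp add: fusion_comb_def distrib_right sum.distrib)

lemma fusion_comb_scale: "fusion_comb n (\<lambda>k. c * h k) i j = c * fusion_comb n h i j"
  by (simp add: fusion_comb_def sum_distrib_left mult.assoc)

lemma fusion_comb_sym: "fusion_comb n h j i = fusion_comb n h i j"
  by (simp add: fusion_comb_def fusion_commute)

lemma supported_fusion_comb: "supported n (fusion_comb n h)"
  by (auto simp: supported_def fusion_comb_def fusion_eq_0)

lemma fusion_comb_1: "i \<in> {1..n} \<Longrightarrow> fusion_comb n h i 1 = h i"
  by (simp add: fusion_comb_def fusion_1 if_distrib[of "(*) _"] cong: if_cong)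

text \<open>The recurrence moves multiplication by \<open>S\<close> onto the index \<open>k\<close>,
  and summation by parts then moves it onto the coefficients.\<close>

lemma row_op_fusion_comb:
  assumes "h 0 = 0" "h (n + 1) = 0" "i \<in> {1..n}" "j \<in> {1..n}"
  shows "row_op n (fusion_comb n h) i j = fusion_comb n (\<lambda>k. h (k - 1) + h (k + 1)) i j"
proof -
  have "row_op n (fusion_comb n h) i j =
      (\<Sum>k\<in>{1..n}. h k * (fusion n (i - 1) j k + fusion n (i + 1) j k))"
    using assms by (simp add: row_op_def fusion_comb_def sum.distrib algebra_simps)
  also have "\<dots> = (\<Sum>k\<in>{1..n}. h k * (fusion n i j (k - 1) + fusion n i j (k + 1)))"
    using assms by (intro sum.cong) (auto simp: fusion_recurrence)
  also have "\<dots> = fusion_comb n (\<lambda>k. h (k - 1) + h (k + 1)) i j"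
    unfolding fusion_comb_def using assms by (intro sum_shift_adjoint[symmetric]) (auto simp: fusion_eq_0)
  finally show ?thesis .
qed

lemma col_op_fusion_comb:
  "col_op n (fusion_comb n h) i j = row_op n (fusion_comb n h) j i"
  by (simp add: row_op_def col_op_def fusion_comb_sym[of n h i] conj_commute)

lemma anticommutator_fusion_comb:
  assumes "h 0 = 0" "h (n + 1) = 0" "i \<in> {1..n}" "j \<in> {1..n}"
  shows "anticommutator n (fusion_comb n h) i j = fusion_comb n (\<lambda>k. 2 * (h (k - 1) + h (k + 1))) i j"
  using assms fusion_comb_sym[of n _ i j]
  by (simp add: anticommutator_def col_op_fusion_comb row_op_fusion_comb)
    (simp add: fusion_comb_def sum_distrib_left sum.distrib algebra_simps)

lemma commutator_fusion_comb: "commutator n (fusion_comb n h) i j = 0"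
proof -
  \<comment> \<open>Truncation does not change the combination but supplies the zero boundary values
    that \<open>row_op_fusion_comb\<close> requires.\<close>
  define h' where "h' k = (if k \<in> {1..n} then h k else 0)" for k
  have eq: "fusion_comb n h = fusion_comb n h'"
    by (auto simp: fusion_comb_def h'_def fun_eq_iff intro!: sum.cong)
  show ?thesis
  proof (cases "i \<in> {1..n} \<and> j \<in> {1..n}")
    case True
    then show ?thesis
      unfolding eq
      by (simp add: commutator_def col_op_fusion_comb row_op_fusion_comb h'_def
          fusion_comb_sym[of n _ i j])
  qed (auto simp: commutator_def row_op_def col_op_def)
qed

text \<open>Commuting with \<open>S\<close> gives
  \<open>X i (j + 1) = X (i - 1) j + X (i + 1) j - X i (j - 1)\<close>, so each column is determined
  by the two before it, and column 0 is zero by support.\<close>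

lemma commutator_eq_0_imp_eq_0:
  assumes X: "supported n X" and comm: "\<And>i j. commutator n X i j = 0" and col: "\<And>i. X i 1 = 0"
  shows "X i j = 0"
proof -
  have "\<forall>i. X i (int m) = 0" for m
  proof (induction m rule: less_induct)
    case (less m)
    consider "m = 0" | "m = 1" | "int m > n" | p where "m = Suc (Suc p)" "int m \<le> n"
      by (metis One_nat_def not_le_imp_less old.nat.exhaust)
    then show ?case
    proof cases
      case 4
      have "X i (int m) = 0" if i: "i \<in> {1..n}" for i
        using comm[of i "int (Suc p)"] less.IH[of p] less.IH[of "Suc p"] 4 i
        by (simp add: commutator_def row_op_def col_op_def algebra_simps)
      then show ?thesis using X by (auto simp: supported_def)
    qed (use X col in \<open>auto simp: supported_def\<close>)
  qed
  from this[of "nat j"] show ?thesis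
    using X by (cases "j \<ge> 0") (auto simp: supported_def)
qed

text \<open>Subtracting the combination with the same first column leaves a matrix that commutes
  with \<open>S\<close> and has zero first column, hence vanishes.\<close>

lemma commutator_eq_0_imp_fusion_comb:
  assumes "supported n X" "\<And>i j. commutator n X i j = 0"
  shows "X i j = fusion_comb n (\<lambda>k. X k 1) i j"
proof -
  let ?Y = "\<lambda>i j. X i j + (-1) * fusion_comb n (\<lambda>k. X k 1) i j"
  have "supported n ?Y"
    using assms(1) supported_fusion_comb by (auto simp: supported_def)
  moreover have "commutator n ?Y i j = 0" for i j
    by (simp only: commutator_add commutator_scale) (simp add: assms commutator_fusion_comb)
  moreover have "?Y i 1 = 0" for i
    using assms(1) supported_fusion_comb[of n "\<lambda>k. X k 1"]
    by (cases "i \<in> {1..n}") (auto simp: fusion_comb_1 supported_def)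
  ultimately have "?Y i j = 0"
    by (rule commutator_eq_0_imp_eq_0)
  then show ?thesis by simp
qed

lemma commutator_plus_fusion_comb_inj:
  assumes X: "supported n X" and anti: "\<And>i j. X j i = - X i j"
    and eq: "\<And>i j. i \<in> {1..n} \<Longrightarrow> j \<in> {1..n} \<Longrightarrow> commutator n X i j + fusion_comb n h i j = 0"
  shows "X i j = 0" and "k \<in> {1..n} \<Longrightarrow> h k = 0"
proof -
  let ?Z = "fusion_comb n h"
  \<comment> \<open>Moving the commutator to the other factor hits \<open>?Z\<close>, which commutes
    with \<open>S\<close>. By \<open>eq\<close> the same sum is minus the squared norm of
    \<open>?Z\<close>.\<close>
  have "(\<Sum>i\<in>{1..n}. \<Sum>j\<in>{1..n}. commutator n X i j * ?Z i j) = 0"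
    by (simp add: commutator_adjoint X supported_fusion_comb commutator_fusion_comb)
  moreover have "(\<Sum>i\<in>{1..n}. \<Sum>j\<in>{1..n}. commutator n X i j * ?Z i j) =
      (\<Sum>i\<in>{1..n}. \<Sum>j\<in>{1..n}. - (?Z i j * ?Z i j))"
  proof (intro sum.cong refl)
    fix i j assume "i \<in> {1..n}" "j \<in> {1..n}"
    from eq[OF this] have "commutator n X i j = - ?Z i j" by simp
    then show "commutator n X i j * ?Z i j = - (?Z i j * ?Z i j)" by simp
  qed
  ultimately have "(\<Sum>i\<in>{1..n}. \<Sum>j\<in>{1..n}. ?Z i j * ?Z i j) = 0"
    by (simp add: sum_negf)
  then have Z0: "?Z i j = 0" if "i \<in> {1..n}" "j \<in> {1..n}" for i j
    using that by (simp add: sum_nonneg_eq_0_iff sum_nonneg)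
  then show "k \<in> {1..n} \<Longrightarrow> h k = 0"
    using fusion_comb_1[of k n h] by auto
  have "commutator n X i j = 0" for i j
    using eq[of i j] Z0[of i j] supported_ops(3)[of n X] by (auto simp: supported_def)
  with X have rep: "X i j = fusion_comb n (\<lambda>k. X k 1) i j" for i j
    by (rule commutator_eq_0_imp_fusion_comb)
  \<comment> \<open>Commuting with \<open>S\<close> forces \<open>X\<close> to be a combination of
    symmetric matrices, against its antisymmetry.\<close>
  have "X j i = X i j"
    by (subst (1 2) rep) (rule fusion_comb_sym)
  with anti[of j i] show "X i j = 0" by simp
qed


section \<open>Antisymmetric matrices\<close>

definition antisym_ext :: "int \<Rightarrow> (int \<times> int \<Rightarrow> real) \<Rightarrow> int \<Rightarrow> int \<Rightarrow> real" where
  "antisym_ext n g i j =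
    (if 1 \<le> i \<and> i < j \<and> j \<le> n then g (i, j)
     else if 1 \<le> j \<and> j < i \<and> i \<le> n then - g (j, i) else 0)"

lemma antisym_ext_antisym: "antisym_ext n g j i = - antisym_ext n g i j"
  by (simp add: antisym_ext_def)

lemma supported_antisym_ext: "supported n (antisym_ext n g)"
  by (auto simp: supported_def antisym_ext_def)

lemma antisym_ext_add: "antisym_ext n (\<lambda>p. g p + h p) = (\<lambda>i j. antisym_ext n g i j + antisym_ext n h i j)"
  by (simp add: antisym_ext_def fun_eq_iff)

lemma antisym_ext_scale: "antisym_ext n (\<lambda>p. c * g p) = (\<lambda>i j. c * antisym_ext n g i j)"
  by (simp add: antisym_ext_def fun_eq_iff)

lemma anticommutator_transpose_antisym:
  assumes "\<And>i j. X j i = - X i j"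
  shows "anticommutator n X j i = - anticommutator n X i j"
  using assms[of "i - 1"] assms[of "i + 1"] assms[of _ "j - 1"] assms[of _ "j + 1"]
  by (simp add: anticommutator_def row_op_def col_op_def)

text \<open>The anticommutator preserves antisymmetry, so it is enough to compare entries above the
  diagonal.\<close>

lemma anticommutator_antisym_ext:
  assumes g: "\<And>i j. 1 \<le> i \<Longrightarrow> i < j \<Longrightarrow> j \<le> n \<Longrightarrow>
    g' (i, j) = antisym_ext n g (i - 1) j + antisym_ext n g (i + 1) j
      + antisym_ext n g i (j - 1) + antisym_ext n g i (j + 1)"
  shows "anticommutator n (antisym_ext n g) i j = antisym_ext n g' i j"
proof -
  let ?D = "anticommutator n (antisym_ext n g)"
  have anti: "?D j i = - ?D i j" for i j
    by (intro anticommutator_transpose_antisym antisym_ext_antisym)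
  have upper: "?D i j = g' (i, j)" if "1 \<le> i" "i < j" "j \<le> n" for i j
    using that g[of i j] by (simp add: anticommutator_def row_op_def col_op_def)
  have "?D i j = 0" if "i = j \<or> i \<notin> {1..n} \<or> j \<notin> {1..n}"
    using that anti[of i i] supported_ops(4)[of n "antisym_ext n g"] by (auto simp: supported_def)
  then show ?thesis
    using upper[of i j] upper[of j i] anti[of i j] by (auto simp: antisym_ext_def[of n g'])
qed

section \<open>Similarity from an intertwining operator\<close>

text \<open>By linearity and \<open>cong\<close>, \<open>T\<close> is given by a matrix.
  Intertwining makes this matrix conjugate one adjacency matrix into the other once it is
  invertible, which follows from injectivity and equal vertex counts.\<close>

lemma similar_graphsI:
  fixes G :: "'a wgraph" and H :: "'b wgraph" and T :: "('b \<Rightarrow> real) \<Rightarrow> 'a \<Rightarrow> real"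
  assumes fin: "finite (verts G)" "finite (verts H)" and card: "card (verts G) = card (verts H)"
    and add: "\<And>f g u. T (\<lambda>w. f w + g w) u = T f u + T g u"
    and scale: "\<And>c f u. T (\<lambda>w. c * f w) u = c * T f u"
    and cong: "\<And>f g u. (\<And>w. w \<in> verts H \<Longrightarrow> f w = g w) \<Longrightarrow> T f u = T g u"
    and intertwine: "\<And>f u. u \<in> verts G \<Longrightarrow>
      (\<Sum>v\<in>verts G. adj_entry G u v * T f v) = T (\<lambda>w. \<Sum>w'\<in>verts H. adj_entry H w w' * f w') u"
    and inj: "\<And>f w. (\<And>u. u \<in> verts G \<Longrightarrow> T f u = 0) \<Longrightarrow> w \<in> verts H \<Longrightarrow> f w = 0"
  shows "G \<sim>\<^sub>G H"
proof -
  define \<delta> :: "'b \<Rightarrow> 'b \<Rightarrow> real" where "\<delta> x w = (if w = x then 1 else 0)" for x w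
  define K where "K u x = T (\<delta> x) u" for u x
  have partial: "T (\<lambda>w. \<Sum>x\<in>S. f x * \<delta> x w) u = (\<Sum>x\<in>S. K u x * f x)" if "finite S" for S f u
    using that
  proof (induction S rule: finite_induct)
    case empty
    show ?case using scale[of 0 "\<lambda>_. 0" u] by simp
  next
    case (insert x S)
    then show ?case by (simp add: add scale K_def)
  qed
  have expand: "T f u = (\<Sum>x\<in>verts H. K u x * f x)" for f u
  proof -
    have "T f u = T (\<lambda>w. \<Sum>x\<in>verts H. f x * \<delta> x w) u"
      using fin by (intro cong) (simp add: \<delta>_def if_distrib[of "(*) _"] cong: if_cong)
    then show ?thesis using partial[OF fin(2)] by simp
  qed
  have inter: "(\<Sum>v\<in>verts G. adj_entry G u v * K v x) = (\<Sum>w\<in>verts H. K u w * adj_entry H w x)"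
    if "u \<in> verts G" "x \<in> verts H" for u x
  proof -
    have "(\<Sum>w'\<in>verts H. adj_entry H w w' * \<delta> x w') = adj_entry H w x" for w
      using fin that by (simp add: \<delta>_def if_distrib[of "(*) _"] cong: if_cong)
    then show ?thesis
      using intertwine[OF that(1), of "\<delta> x"] by (simp add: K_def[symmetric] expand[of "\<lambda>w. adj_entry H w x"])
  qed
  have "similar_mat (Defs.adj_mat G us) (Defs.adj_mat H vs)" if us: "vertex_enum G us" and vs: "vertex_enum H vs" for us vs
  proof -
    define m where "m = card (verts G)"
    have len: "length us = m" "length vs = m"
      using us vs card by (auto simp: vertex_enum_def m_def distinct_card[symmetric])
    have us_nth: "us ! i \<in> verts G" and vs_nth: "vs ! i \<in> verts H" if "i < m" for i
      using us vs len that by (auto simp: vertex_enum_def)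
    have us_sum: "(\<Sum>i\<in>{0..<m}. g (us ! i)) = (\<Sum>u\<in>verts G. g u)" for g :: "'a \<Rightarrow> real"
      using us len by (intro sum.reindex_bij_betw bij_betw_nth) (auto simp: vertex_enum_def)
    have vs_sum: "(\<Sum>i\<in>{0..<m}. g (vs ! i)) = (\<Sum>u\<in>verts H. g u)" for g :: "'b \<Rightarrow> real"
      using vs len by (intro sum.reindex_bij_betw bij_betw_nth) (auto simp: vertex_enum_def)
    define A B P where "A = Defs.adj_mat G us" and "B = Defs.adj_mat H vs"
      and "P = mat m m (\<lambda>(i, j). K (us ! i) (vs ! j))"
    have carrier: "A \<in> carrier_mat m m" "B \<in> carrier_mat m m" "P \<in> carrier_mat m m"
      by (auto simp: A_def B_def P_def Defs.adj_mat_def len)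
    have AP: "A * P = P * B"
    proof (rule eq_matI)
      fix i j assume "i < dim_row (P * B)" "j < dim_col (P * B)"
      with carrier have ij: "i < m" "j < m" by auto
      have "(A * P) $$ (i, j) = (\<Sum>k\<in>{0..<m}. adj_entry G (us ! i) (us ! k) * K (us ! k) (vs ! j))"
        using ij by (simp add: A_def P_def Defs.adj_mat_def len scalar_prod_def)
      also have "\<dots> = (\<Sum>k\<in>{0..<m}. K (us ! i) (vs ! k) * adj_entry H (vs ! k) (vs ! j))"
        using inter[OF us_nth vs_nth] ij
          us_sum[of "\<lambda>u. adj_entry G (us ! i) u * K u (vs ! j)"]
          vs_sum[of "\<lambda>w. K (us ! i) w * adj_entry H w (vs ! j)"] by simp
      also have "\<dots> = (P * B) $$ (i, j)"
        using ij by (simp add: B_def P_def Defs.adj_mat_def len scalar_prod_def)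
      finally show "(A * P) $$ (i, j) = (P * B) $$ (i, j)" .
    qed (use carrier in auto)
    have "det P \<noteq> 0"
    proof
      assume "det P = 0"
      then obtain v where v: "v \<in> carrier_vec m" "v \<noteq> 0\<^sub>v m" "P *\<^sub>v v = 0\<^sub>v m"
        using det_0_iff_vec_prod_zero_field[OF carrier(3)] by blast
      \<comment> \<open>A kernel vector of \<open>P\<close> is read as a function on the vertices of
        \<open>H\<close> by inverting the enumeration \<open>vs\<close>.\<close>
      define f where "f w = v $ (THE i. i < m \<and> vs ! i = w)" for w
      have f: "f (vs ! i) = v $ i" if "i < m" for i
      proof -
        have "(THE k. k < m \<and> vs ! k = vs ! i) = i"
          using that vs len by (intro the_equality) (auto simp: vertex_enum_def nth_eq_iff_index_eq)
        then show ?thesis by (simp add: f_def)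
      qed
      have "T f (us ! i) = 0" if "i < m" for i
      proof -
        have "T f (us ! i) = (\<Sum>k\<in>{0..<m}. K (us ! i) (vs ! k) * f (vs ! k))"
          by (simp add: expand vs_sum[of "\<lambda>w. K (us ! i) w * f w"])
        also have "\<dots> = (\<Sum>k\<in>{0..<m}. K (us ! i) (vs ! k) * v $ k)"
          by (intro sum.cong) (auto simp: f)
        also have "\<dots> = (P *\<^sub>v v) $ i"
          using that v(1) by (simp add: P_def scalar_prod_def)
        finally show ?thesis using that v(3) by simp
      qed
      then have "T f u = 0" if "u \<in> verts G" for u
        using that us len unfolding vertex_enum_def by (metis in_set_conv_nth)
      then have "f w = 0" if "w \<in> verts H" for w
        using that inj by blast
      then have "v $ i = 0" if "i < m" for i
        using f[OF that] vs_nth[OF that] by simp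
      then have "v = 0\<^sub>v m" using v(1) by (intro eq_vecI) auto
      with v(2) show False by simp
    qed
    then obtain Q where Q: "Q \<in> carrier_mat m m" "P * Q = 1\<^sub>m m" "Q * P = 1\<^sub>m m"
      using det_non_zero_imp_unit[OF carrier(3), of "()"]
      by (auto simp: Units_def ring_mat_def)
    have "A = A * (P * Q)" using carrier Q by simp
    also have "\<dots> = (A * P) * Q" using carrier Q by simp
    finally have "A = P * B * Q" by (simp only: AP)
    then have "similar_mat_wit A B P Q"
      using carrier Q unfolding similar_mat_wit_def by (auto simp: Let_def)
    then show ?thesis unfolding A_def B_def similar_mat_def by blast
  qed
  then show ?thesis
    using fin by (simp add: similar_graphs_def)
qed

section \<open>Adjacency operators of the grid, the quartered Aztec diamond and the path\<close>

lemma adj_entry_nearest_neighbor_graph: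
  "adj_entry (nearest_neighbor_graph S) u v =
    (if u \<in> S \<and> v \<in> S \<and> \<bar>fst u - fst v\<bar> + \<bar>snd u - snd v\<bar> = 1 then 1 else 0)"
proof -
  have "{u, v} \<in> edges (nearest_neighbor_graph S) \<longleftrightarrow>
      u \<in> S \<and> v \<in> S \<and> \<bar>fst u - fst v\<bar> + \<bar>snd u - snd v\<bar> = 1" (is "?l \<longleftrightarrow> ?r")
  proof
    show "?l \<Longrightarrow> ?r"
      by (auto simp: nearest_neighbor_graph_def doubleton_eq_iff abs_minus_commute)
    show "?r \<Longrightarrow> ?l"
      unfolding nearest_neighbor_graph_def wgraph.simps mem_Collect_eq by blast
  qed
  then show ?thesis by (simp add: adj_entry_def nearest_neighbor_graph_def)
qed

lemma adj_entry_induced_subgraph: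
  "adj_entry (induced_subgraph G S) u v = (if u \<in> S \<and> v \<in> S then adj_entry G u v else 0)"
  by (auto simp: adj_entry_def induced_subgraph_def)

lemma adj_entry_weighted_path:
  "adj_entry (weighted_path c n) i j =
    (if i \<in> {1..n} \<and> j \<in> {1..n} \<and> (j = Suc i \<or> i = Suc j) then c else 0)"
  by (auto simp: adj_entry_def weighted_path_def doubleton_eq_iff)

lemma sum_nearest_neighbors:
  fixes h :: "int \<times> int \<Rightarrow> real"
  assumes "finite S"
  shows "(\<Sum>q\<in>S. (if \<bar>i - fst q\<bar> + \<bar>j - snd q\<bar> = 1 then 1 else 0) * h q) =
    (if (i - 1, j) \<in> S then h (i - 1, j) else 0) + (if (i + 1, j) \<in> S then h (i + 1, j) else 0)
    + (if (i, j - 1) \<in> S then h (i, j - 1) else 0) + (if (i, j + 1) \<in> S then h (i, j + 1) else 0)"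
proof -
  let ?N = "{(i - 1, j), (i + 1, j), (i, j - 1), (i, j + 1)}"
  have N: "\<bar>i - fst q\<bar> + \<bar>j - snd q\<bar> = 1 \<longleftrightarrow> q \<in> ?N" for q
    by (cases q) (auto; presburger)
  have "(\<Sum>q\<in>S. (if \<bar>i - fst q\<bar> + \<bar>j - snd q\<bar> = 1 then 1 else 0) * h q) =
      (\<Sum>q\<in>S. if q \<in> ?N then h q else 0)"
    by (intro sum.cong refl) (simp only: N, simp)
  \<comment> \<open>Both sums run over the intersection of \<open>S\<close> and \<open>?N\<close>;
    the second one has only four explicit terms.\<close>
  also have "\<dots> = (\<Sum>q\<in>?N. if q \<in> S then h q else 0)"
    using assms by (simp only: sum.inter_restrict[symmetric] finite.intros Int_commute)
  finally show ?thesis by (simp add: add.assoc)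
qed


lemma adj_entry_grid_graph:
  "u \<in> verts (grid_graph n) \<Longrightarrow> v \<in> verts (grid_graph n) \<Longrightarrow>
    adj_entry (grid_graph n) u v = (if \<bar>fst u - fst v\<bar> + \<bar>snd u - snd v\<bar> = 1 then 1 else 0)"
  by (simp add: grid_graph_def int_lattice_def adj_entry_induced_subgraph adj_entry_nearest_neighbor_graph)
    (simp add: induced_subgraph_def)

lemma verts_grid_graph: "verts (grid_graph n) = {1..int n} \<times> {1..int n}"
  by (simp add: grid_graph_def int_lattice_def induced_subgraph_def nearest_neighbor_graph_def)

lemma grid_graph_adjacency_sum:
  assumes "supported (int n) X" "(i, j) \<in> verts (grid_graph n)"
  shows "(\<Sum>v\<in>verts (grid_graph n). adj_entry (grid_graph n) (i, j) v * case_prod X v) =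
    anticommutator (int n) X i j"
proof -
  have "(\<Sum>v\<in>verts (grid_graph n). adj_entry (grid_graph n) (i, j) v * case_prod X v) =
      (\<Sum>v\<in>verts (grid_graph n). (if \<bar>i - fst v\<bar> + \<bar>j - snd v\<bar> = 1 then 1 else 0) * case_prod X v)"
    using assms(2) by (intro sum.cong refl) (simp add: adj_entry_grid_graph)
  also have "\<dots> = X (i - 1) j + X (i + 1) j + X i (j - 1) + X i (j + 1)"
    using assms(1) by (subst sum_nearest_neighbors) (auto simp: verts_grid_graph supported_def)
  finally show ?thesis
    using assms(2) by (simp add: verts_grid_graph anticommutator_def row_op_def col_op_def)
qed

definition triangle :: "int \<Rightarrow> (int \<times> int) set" where
  "triangle n = {(i, j). 1 \<le> i \<and> i < j \<and> j \<le> n}"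

lemma finite_triangle: "finite (triangle n)"
  by (rule finite_subset[of _ "{1..n} \<times> {1..n}"]) (auto simp: triangle_def)

text \<open>The square splits into the strict upper triangle, its mirror image and the
  diagonal.\<close>

lemma card_grid_triangle: "card ({1..int n} \<times> {1..int n}) = 2 * card (triangle (int n)) + n"
proof -
  let ?T = "triangle (int n)"
  have "{1..int n} \<times> {1..int n} = ?T \<union> (prod.swap ` ?T \<union> (\<lambda>i. (i, i)) ` {1..int n})"
    by (force simp: triangle_def image_iff)
  moreover have "card (prod.swap ` ?T) = card ?T" "card ((\<lambda>i. (i, i)) ` {1..int n}) = n"
    by (simp_all add: card_image inj_on_def prod_eq_iff)
  moreover have "?T \<inter> (prod.swap ` ?T \<union> (\<lambda>i. (i, i)) ` {1..int n}) = {}"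
    "prod.swap ` ?T \<inter> (\<lambda>i. (i, i)) ` {1..int n} = {}"
    by (auto simp: triangle_def)
  ultimately show ?thesis
    by (simp add: card_Un_disjoint finite_triangle)
qed

text \<open>
  Identifies the strict upper triangle of the grid with \<open>QAD\<^sub>n\<^sub>-\<^sub>1\<close>: the column index is reflected and
  then placed in the southeastern quarter.
\<close>

definition quarter_point :: "nat \<Rightarrow> int \<times> int \<Rightarrow> real \<times> real" where
  "quarter_point n p = (of_int (fst p) - 1/2, of_int (snd p) - real n - 1/2)"

lemma inj_quarter_point: "inj (quarter_point n)"
  by (auto simp: inj_on_def quarter_point_def prod_eq_iff)

text \<open>Under \<open>j' = n + 1 - j\<close> the condition \<open>i < j\<close> becomes
  \<open>i + j' \<le> n\<close>.\<close>

lemma verts_quarter: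
  assumes "n \<ge> 1"
  shows "verts (quartered_aztec_diamond (n - 1)) = quarter_point n ` triangle (int n)"
proof -
  have "{(i, j). 1 \<le> i \<and> 1 \<le> j \<and> i + j \<le> n - 1 + 1} =
      (\<lambda>(i, j). (nat i, nat (int n + 1 - j))) ` triangle (int n)"
  proof (intro equalityI subsetI)
    fix p assume "p \<in> {(i, j). 1 \<le> i \<and> 1 \<le> j \<and> i + j \<le> n - 1 + 1}"
    then show "p \<in> (\<lambda>(i, j). (nat i, nat (int n + 1 - j))) ` triangle (int n)"
      using assms by (intro image_eqI[of _ _ "(int (fst p), int n + 1 - int (snd p))"])
        (auto simp: triangle_def)
  qed (use assms in \<open>auto simp: triangle_def\<close>)
  then show ?thesis
    unfolding verts_quartered_aztec_diamond
    by (simp add: image_image case_prod_unfold quarter_point_def)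
      (rule image_cong; auto simp: triangle_def)
qed

text \<open>The reflection is undone by the sign of the second coordinate, so
  \<open>quarter_point\<close> is a translation and preserves distances.\<close>

lemma adj_entry_quarter:
  assumes "n \<ge> 1" "p \<in> triangle (int n)" "q \<in> triangle (int n)"
  shows "adj_entry (quartered_aztec_diamond (n - 1)) (quarter_point n p) (quarter_point n q) =
    (if \<bar>fst p - fst q\<bar> + \<bar>snd p - snd q\<bar> = 1 then 1 else 0)"
proof -
  let ?u = "quarter_point n p" and ?v = "quarter_point n q"
  have "?u \<in> verts (quartered_aztec_diamond (n - 1))" "?v \<in> verts (quartered_aztec_diamond (n - 1))"
    using assms by (simp_all add: verts_quarter del: One_nat_def)
  then have "adj_entry (quartered_aztec_diamond (n - 1)) ?u ?v =
      (if \<bar>fst ?u - fst ?v\<bar> + \<bar>snd ?u - snd ?v\<bar> = 1 then 1 else 0)"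
    unfolding quartered_aztec_diamond_def aztec_diamond_def half_int_lattice_def
      adj_entry_induced_subgraph adj_entry_nearest_neighbor_graph
    by (simp add: induced_subgraph_def nearest_neighbor_graph_def)
  also have "\<bar>fst ?u - fst ?v\<bar> + \<bar>snd ?u - snd ?v\<bar> =
      real_of_int (\<bar>fst p - fst q\<bar> + \<bar>snd p - snd q\<bar>)"
    by (simp add: quarter_point_def)
  finally show ?thesis by (simp only: of_int_eq_1_iff)
qed

lemma quarter_adjacency_sum:
  fixes f :: "real \<times> real \<Rightarrow> real"
  assumes "n \<ge> 1"
  defines "g \<equiv> f \<circ> quarter_point n"
    and "g' \<equiv> (\<lambda>w. \<Sum>w'\<in>verts (quartered_aztec_diamond (n - 1)).
      adj_entry (quartered_aztec_diamond (n - 1)) w w' * f w') \<circ> quarter_point n"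
  shows "antisym_ext (int n) g' i j = anticommutator (int n) (antisym_ext (int n) g) i j"
proof (rule anticommutator_antisym_ext[symmetric])
  fix i j :: int assume ij: "1 \<le> i" "i < j" "j \<le> int n"
  then have T: "(i, j) \<in> triangle (int n)" by (simp add: triangle_def)
  have "g' (i, j) = (\<Sum>q\<in>triangle (int n). (if \<bar>i - fst q\<bar> + \<bar>j - snd q\<bar> = 1 then 1 else 0) * g q)"
    unfolding g'_def g_def comp_def verts_quarter[OF assms(1)]
      sum.reindex[OF inj_on_subset[OF inj_quarter_point subset_UNIV]]
    by (intro sum.cong refl) (simp add: adj_entry_quarter[OF assms(1) T] del: One_nat_def)
  also have "\<dots> = antisym_ext (int n) g (i - 1) j + antisym_ext (int n) g (i + 1) j
      + antisym_ext (int n) g i (j - 1) + antisym_ext (int n) g i (j + 1)"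
    \<comment> \<open>A neighbour of \<open>(i, j)\<close> outside the triangle lies on the diagonal
      or off the square, and \<open>antisym_ext\<close> is 0 in both places.\<close>
    using ij unfolding sum_nearest_neighbors[OF finite_triangle]
    by (auto simp: triangle_def antisym_ext_def)
  finally show "g' (i, j) = antisym_ext (int n) g (i - 1) j + antisym_ext (int n) g (i + 1) j
      + antisym_ext (int n) g i (j - 1) + antisym_ext (int n) g i (j + 1)" .
qed

text \<open>Passes from the natural-number vertices of the path to integer coefficients, with the
  zero values at \<open>0\<close> and \<open>n + 1\<close> built in.\<close>

definition path_ext :: "nat \<Rightarrow> (nat \<Rightarrow> real) \<Rightarrow> int \<Rightarrow> real" where
  "path_ext n h k = (if k \<in> {1..int n} then h (nat k) else 0)"

lemma path_ext_add: "path_ext n (\<lambda>k. g k + h k) = (\<lambda>k. path_ext n g k + path_ext n h k)"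
  by (simp add: path_ext_def fun_eq_iff)

lemma path_ext_scale: "path_ext n (\<lambda>k. c * h k) = (\<lambda>k. c * path_ext n h k)"
  by (simp add: path_ext_def fun_eq_iff)

lemma path_adjacency_sum:
  assumes "k \<in> {1..int n}"
  shows "path_ext n (\<lambda>i. \<Sum>j\<in>{1..n}. adj_entry (weighted_path c n) i j * h j) k =
    c * (path_ext n h (k - 1) + path_ext n h (k + 1))"
proof -
  have "path_ext n (\<lambda>i. \<Sum>j\<in>{1..n}. adj_entry (weighted_path c n) i j * h j) k =
      (\<Sum>j\<in>{1..n}. (if j = nat (k - 1) then c * h j else 0) + (if j = nat (k + 1) then c * h j else 0))"
  proof -
    have "adj_entry (weighted_path c n) (nat k) j * h j =
        (if j = nat (k - 1) then c * h j else 0) + (if j = nat (k + 1) then c * h j else 0)"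
      if "j \<in> {1..n}" for j
    proof -
      have "nat k \<in> {1..n}" "j = Suc (nat k) \<longleftrightarrow> j = nat (k + 1)" "nat k = Suc j \<longleftrightarrow> j = nat (k - 1)"
        "j = nat (k + 1) \<Longrightarrow> j \<noteq> nat (k - 1)"
        using assms that by auto
      then show ?thesis using that by (simp only: adj_entry_weighted_path) simp
    qed
    then show ?thesis using assms by (simp only: path_ext_def if_True cong: sum.cong)
  qed
  also have "\<dots> = (if nat (k - 1) \<in> {1..n} then c * h (nat (k - 1)) else 0)
      + (if nat (k + 1) \<in> {1..n} then c * h (nat (k + 1)) else 0)"
    by (simp only: sum.distrib sum.delta finite_atLeastAtMost)
  also have "\<dots> = c * (path_ext n h (k - 1) + path_ext n h (k + 1))"
  proof -
    \<comment> \<open>At \<open>k = 1\<close> the truncated index is \<open>0\<close>, still outside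
      \<open>{1..n}\<close>, so the missing neighbour of the endpoint matches the zero of
      \<open>path_ext\<close>.\<close>
    have "nat (k - 1) \<in> {1..n} \<longleftrightarrow> k - 1 \<in> {1..int n}" "nat (k + 1) \<in> {1..n} \<longleftrightarrow> k + 1 \<in> {1..int n}"
      using assms by auto
    then show ?thesis by (simp only: path_ext_def distrib_left if_distrib[of "(*) c"] mult_zero_right)
  qed
  finally show ?thesis .
qed

section \<open>The grid graph\<close>

text \<open>The first summand is antisymmetric and the other two are symmetric, which lets the
  components be separated again.\<close>

definition grid_intertwiner ::
    "nat \<Rightarrow> (real \<times> real + real \<times> real + nat \<Rightarrow> real) \<Rightarrow> int \<Rightarrow> int \<Rightarrow> real" where
  "grid_intertwiner n f i j =
     antisym_ext (int n) (\<lambda>p. f (Inl (quarter_point n p))) i j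
     + commutator (int n) (antisym_ext (int n) (\<lambda>p. f (Inr (Inl (quarter_point n p))))) i j
     + fusion_comb (int n) (path_ext n (\<lambda>k. f (Inr (Inr k)))) i j"

theorem theorem2p1:
  fixes n :: nat
  assumes "n \<ge> 1"
  shows "grid_graph n \<sim>\<^sub>G
    quartered_aztec_diamond (n - 1) \<union>\<^sub>G quartered_aztec_diamond (n - 1) \<union>\<^sub>G weighted_path 2 n"
proof -
  let ?Q = "quartered_aztec_diamond (n - 1)" and ?P = "weighted_path 2 n"
  let ?H = "?Q \<union>\<^sub>G ?Q \<union>\<^sub>G ?P"
  let ?N = "int n"
  note One_nat_def[simp del]
  have verts_P: "verts ?P = {1..n}" by (simp add: weighted_path_def)
  have verts_H: "verts ?H = verts ?Q <+> (verts ?Q <+> {1..n})"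
    by (auto simp: disjoint_union_def verts_P)
  have fin_Q: "finite (verts ?Q)" by (rule finite_verts_quartered_aztec_diamond)
  have card_Q: "card (verts ?Q) = card (triangle ?N)"
    using assms by (simp add: verts_quarter card_image inj_on_subset[OF inj_quarter_point])
  have sum_H: "(\<Sum>w\<in>verts ?H. g w) = (\<Sum>w\<in>verts ?Q. g (Inl w)) + (\<Sum>w\<in>verts ?Q. g (Inr (Inl w)))
      + (\<Sum>k\<in>{1..n}. g (Inr (Inr k)))" for g :: "_ \<Rightarrow> real"
    by (simp add: verts_H sum.Plus fin_Q add.assoc)
  show ?thesis
  proof (rule similar_graphsI[where T = "\<lambda>f. case_prod (grid_intertwiner n f)"])
    show "finite (verts (grid_graph n))" by (simp add: verts_grid_graph)
    show "finite (verts ?H)" by (simp add: verts_H fin_Q)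
    show "card (verts (grid_graph n)) = card (verts ?H)"
      unfolding verts_grid_graph card_grid_triangle verts_H by (simp add: card_Plus fin_Q card_Q)
  next
    fix f g :: "real \<times> real + real \<times> real + nat \<Rightarrow> real" and u :: "int \<times> int"
    show "case_prod (grid_intertwiner n (\<lambda>w. f w + g w)) u =
        case_prod (grid_intertwiner n f) u + case_prod (grid_intertwiner n g) u"
      by (simp add: case_prod_unfold grid_intertwiner_def antisym_ext_add commutator_add
          path_ext_add fusion_comb_add)
  next
    fix c and f :: "real \<times> real + real \<times> real + nat \<Rightarrow> real" and u :: "int \<times> int"
    show "case_prod (grid_intertwiner n (\<lambda>w. c * f w)) u = c * case_prod (grid_intertwiner n f) u"
      by (simp add: case_prod_unfold grid_intertwiner_def antisym_ext_scale commutator_scale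
          path_ext_scale fusion_comb_scale distrib_left)
  next
    fix f g :: "real \<times> real + real \<times> real + nat \<Rightarrow> real" and u :: "int \<times> int"
    assume eq: "\<And>w. w \<in> verts ?H \<Longrightarrow> f w = g w"
    have *: "f (Inl (quarter_point n p)) = g (Inl (quarter_point n p))"
        "f (Inr (Inl (quarter_point n p))) = g (Inr (Inl (quarter_point n p)))"
      if "p \<in> triangle ?N" for p
      using that by (auto simp: verts_H verts_quarter[OF assms] intro!: eq)
    have **: "f (Inr (Inr (nat k))) = g (Inr (Inr (nat k)))" if "1 \<le> k" "k \<le> ?N" for k
      using that by (intro eq) (simp add: verts_H InrI nat_le_iff le_nat_iff)
    show "case_prod (grid_intertwiner n f) u = case_prod (grid_intertwiner n g) u"
    proof -
      have "antisym_ext ?N (\<lambda>p. f (Inl (quarter_point n p))) = antisym_ext ?N (\<lambda>p. g (Inl (quarter_point n p)))"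
        "antisym_ext ?N (\<lambda>p. f (Inr (Inl (quarter_point n p)))) =
          antisym_ext ?N (\<lambda>p. g (Inr (Inl (quarter_point n p))))"
        "path_ext n (\<lambda>k. f (Inr (Inr k))) = path_ext n (\<lambda>k. g (Inr (Inr k)))"
        using * ** by (auto simp: antisym_ext_def path_ext_def triangle_def fun_eq_iff)
      then show ?thesis by (simp add: grid_intertwiner_def case_prod_unfold)
    qed
  next
    fix f :: "real \<times> real + real \<times> real + nat \<Rightarrow> real" and u :: "int \<times> int"
    assume u: "u \<in> verts (grid_graph n)"
    show "(\<Sum>v\<in>verts (grid_graph n). adj_entry (grid_graph n) u v * case_prod (grid_intertwiner n f) v) =
      case_prod (grid_intertwiner n (\<lambda>w. \<Sum>w'\<in>verts ?H. adj_entry ?H w w' * f w')) u"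
    proof (cases u)
      case (Pair i j)
      let ?a = "antisym_ext ?N (\<lambda>p. f (Inl (quarter_point n p)))"
      let ?b = "antisym_ext ?N (\<lambda>p. f (Inr (Inl (quarter_point n p))))"
      let ?h = "path_ext n (\<lambda>k. f (Inr (Inr k)))"
      let ?Af = "\<lambda>w. \<Sum>w'\<in>verts ?H. adj_entry ?H w w' * f w'"
      have ij: "i \<in> {1..?N}" "j \<in> {1..?N}" using u Pair by (auto simp: verts_grid_graph)
      have X: "grid_intertwiner n f = (\<lambda>i j. ?a i j + commutator ?N ?b i j + fusion_comb ?N ?h i j)"
        by (simp add: grid_intertwiner_def fun_eq_iff)
      have supp: "supported ?N (grid_intertwiner n f)"
        using supported_antisym_ext[of ?N] supported_ops(3)[of ?N ?b] supported_fusion_comb[of ?N ?h]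
        by (simp add: X supported_def)
      have a: "antisym_ext ?N (\<lambda>p. ?Af (Inl (quarter_point n p))) i j = anticommutator ?N ?a i j" for i j
        using quarter_adjacency_sum[OF assms, of "\<lambda>x. f (Inl x)" i j]
        by (simp add: sum_H adj_entry_disjoint_union comp_def)
      \<comment> \<open>An equality of functions is required here, since it is rewritten under the
        outer commutator.\<close>
      have "antisym_ext ?N (\<lambda>p. ?Af (Inr (Inl (quarter_point n p)))) = anticommutator ?N ?b"
        using quarter_adjacency_sum[OF assms, of "\<lambda>x. f (Inr (Inl x))"]
        by (simp add: sum_H adj_entry_disjoint_union comp_def fun_eq_iff)
      then have b: "commutator ?N (antisym_ext ?N (\<lambda>p. ?Af (Inr (Inl (quarter_point n p))))) i j =
          anticommutator ?N (commutator ?N ?b) i j"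
        by (simp add: anticommutator_commutator supported_antisym_ext)
      have "path_ext n (\<lambda>k. ?Af (Inr (Inr k))) k = 2 * (?h (k - 1) + ?h (k + 1))" if "k \<in> {1..?N}" for k
        using path_adjacency_sum[OF that, of 2 "\<lambda>k. f (Inr (Inr k))"]
        by (simp add: sum_H adj_entry_disjoint_union)
      \<comment> \<open>The coefficient formula is available only for \<open>k\<close> in
        \<open>{1..?N}\<close>, which are exactly the indices that \<open>fusion_comb\<close>
        evaluates.\<close>
      then have "fusion_comb ?N (path_ext n (\<lambda>k. ?Af (Inr (Inr k)))) i j =
          fusion_comb ?N (\<lambda>k. 2 * (?h (k - 1) + ?h (k + 1))) i j"
        unfolding fusion_comb_def by (intro sum.cong) auto
      then have h: "fusion_comb ?N (path_ext n (\<lambda>k. ?Af (Inr (Inr k)))) i j =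
          anticommutator ?N (fusion_comb ?N ?h) i j"
        using ij by (subst anticommutator_fusion_comb) (auto simp: path_ext_def)
      have "(\<Sum>v\<in>verts (grid_graph n). adj_entry (grid_graph n) u v * case_prod (grid_intertwiner n f) v) =
          anticommutator ?N (grid_intertwiner n f) i j"
        using grid_graph_adjacency_sum[OF supp] u Pair by simp
      also have "\<dots> = grid_intertwiner n ?Af i j"
        unfolding X by (simp only: anticommutator_add grid_intertwiner_def a b h)
      finally show ?thesis using Pair by simp
    qed
  next
    fix f :: "real \<times> real + real \<times> real + nat \<Rightarrow> real" and w
    assume T0: "\<And>u. u \<in> verts (grid_graph n) \<Longrightarrow> case_prod (grid_intertwiner n f) u = 0"
      and w: "w \<in> verts ?H"
    show "f w = 0"
    proof -
      let ?a = "antisym_ext ?N (\<lambda>p. f (Inl (quarter_point n p)))"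
      let ?b = "antisym_ext ?N (\<lambda>p. f (Inr (Inl (quarter_point n p))))"
      let ?h = "path_ext n (\<lambda>k. f (Inr (Inr k)))"
      have zero: "?a i j + commutator ?N ?b i j + fusion_comb ?N ?h i j = 0"
        if "i \<in> {1..?N}" "j \<in> {1..?N}" for i j
        using T0[of "(i, j)"] that by (simp add: verts_grid_graph grid_intertwiner_def)
      \<comment> \<open>Subtracting \<open>zero\<close> at \<open>(j, i)\<close> from
        \<open>zero\<close> at \<open>(i, j)\<close> cancels the symmetric summands and leaves twice
        \<open>?a i j\<close>.\<close>
      have a: "?a i j = 0" if "i \<in> {1..?N}" "j \<in> {1..?N}" for i j
        using zero[OF that] zero[OF that(2,1)] antisym_ext_antisym[of ?N _ j i]
          commutator_transpose_antisym[of ?b n j i, OF antisym_ext_antisym] fusion_comb_sym[of ?N ?h j i]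
        by simp
      then have bh: "commutator ?N ?b i j + fusion_comb ?N ?h i j = 0"
        if "i \<in> {1..?N}" "j \<in> {1..?N}" for i j
        using zero[OF that] that by simp
      note bh0 = commutator_plus_fusion_comb_inj[OF supported_antisym_ext antisym_ext_antisym bh]
      have "f (Inl (quarter_point n p)) = 0" "f (Inr (Inl (quarter_point n p))) = 0"
        if "p \<in> triangle ?N" for p
        using that a[of "fst p" "snd p"] bh0(1)[of "fst p" "snd p"]
        by (auto simp: triangle_def antisym_ext_def split: if_splits)
      moreover have "f (Inr (Inr k)) = 0" if "k \<in> {1..n}" for k
        using bh0(2)[of "int k"] that by (simp add: path_ext_def)
      ultimately show ?thesis
        using w by (auto simp: verts_H verts_quarter[OF assms])
    qed
  qed
qed

end
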